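(* There is a sequence $(H_n)_{n\in\mathbb{N}}$ of finite Heyting algebras such that for every $n$, $$1 > \mathrm{ds}_{H_n}(a\to b = \neg a \vee b) \geq 1 - \left(\tfrac{3}{4}\right)^{n+1}.$$
   Context: $\neg a$ abbreviates $a\to\bot$. For a finite Heyting algebra $H$, $\mathrm{ds}_H(a\to b=\neg a\vee b) = |\{(a,b)\in H^2 : a\to b = \neg a\vee b\}|/|H|^2$. *)

theory Defs
  imports Complex_Main "HOL-Algebra.Lattice"
begin

record 'a heyting = "'a gorder" +
  himp :: "['a, 'a] \<Rightarrow> 'a" (infixr \<open>\<leadsto>\<index>\<close> 60)

locale heyting_algebra = bounded_lattice H for H (structure) +
  assumes himp_closed [intro, simp]:
      "\<lbrakk>a \<in> carrier H; b \<in> carrier H\<rbrakk> \<Longrightarrow> a \<leadsto> b \<in> carrier H"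
    and residuation:
      "\<lbrakk>a \<in> carrier H; b \<in> carrier H; c \<in> carrier H\<rbrakk>
        \<Longrightarrow> c \<sqsubseteq> a \<leadsto> b \<longleftrightarrow> c \<sqinter> a \<sqsubseteq> b"

definition hneg :: "('a, 'b) heyting_scheme \<Rightarrow> 'a \<Rightarrow> 'a"
  where "hneg H a = a \<leadsto>\<^bsub>H\<^esub> \<bottom>\<^bsub>H\<^esub>"

text \<open>The degree of satisfiability of an equation in two variables, given as the
  relation \<open>E a b\<close> that it defines on \<open>H\<close>.\<close>

definition ds2 :: "('a, 'b) heyting_scheme \<Rightarrow> ('a \<Rightarrow> 'a \<Rightarrow> bool) \<Rightarrow> real"
  where "ds2 H E =
    real (card {(a, b) \<in> carrier H \<times> carrier H. E a b}) / real (card (carrier H)) ^ 2"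

end

theory Submission
  imports Defs "HOL-Library.Nat_Bijection"
begin

text \<open>
  Adjoin a new top element to the Boolean algebra of subsets of an \<open>m\<close>-element set. There
  \<open>a \<rightarrow> b = \<not> a \<or> b\<close> can fail only if \<open>a \<le> b\<close> with \<open>b\<close> below the new top, since otherwise
  implication is computed as in the Boolean algebra. Among the subsets there are \<open>3 ^ m\<close> pairs
  \<open>a \<le> b\<close>, against \<open>(2 ^ m + 1)\<^sup>2 > 4 ^ m\<close> pairs in total; and the equation does fail for
  \<open>a = b \<noteq> \<bottom>\<close>, where \<open>a \<rightarrow> a\<close> is the new top whereas \<open>\<not> a \<or> a\<close> is the old one.
\<close>

section \<open>Finite lattices of sets as Heyting algebras\<close>

definition set_imp :: "'a set set \<Rightarrow> 'a set \<Rightarrow> 'a set \<Rightarrow> 'a set"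
  where "set_imp F A B = \<Union>{C \<in> F. C \<inter> A \<subseteq> B}"

text \<open>Sets are coded by naturals so that the elements have type \<open>nat\<close>; the coding
  is faithful on finite sets.\<close>

definition set_heyting :: "nat set set \<Rightarrow> nat heyting"
  where "set_heyting F =
    \<lparr>carrier = set_encode ` F,
     eq = (=),
     le = (\<lambda>a b. set_decode a \<subseteq> set_decode b),
     himp = (\<lambda>a b. set_encode (set_imp F (set_decode a) (set_decode b)))\<rparr>"

locale finite_set_lattice =
  fixes F :: "nat set set"
  assumes finite_family: "finite F"
    and finite_member: "A \<in> F \<Longrightarrow> finite A"
    and empty_member: "{} \<in> F"
    and Un_member: "\<lbrakk>A \<in> F; B \<in> F\<rbrakk> \<Longrightarrow> A \<union> B \<in> F"
    and Int_member: "\<lbrakk>A \<in> F; B \<in> F\<rbrakk> \<Longrightarrow> A \<inter> B \<in> F"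
begin

abbreviation "H \<equiv> set_heyting F"

lemma decode_encode [simp]: "A \<in> F \<Longrightarrow> set_decode (set_encode A) = A"
  by (simp add: finite_member)

lemma encode_eq_iff: "\<lbrakk>A \<in> F; B \<in> F\<rbrakk> \<Longrightarrow> set_encode A = set_encode B \<longleftrightarrow> A = B"
  by (simp add: finite_member set_encode_eq)

lemma carrier_H: "carrier H = set_encode ` F"
  by (simp add: set_heyting_def)

lemma finite_carrier_H: "finite (carrier H)"
  by (simp add: carrier_H finite_family)

lemma card_carrier_H: "card (carrier H) = card F"
  unfolding carrier_H by (intro card_image inj_onI) (simp add: encode_eq_iff)

lemma le_H: "\<lbrakk>A \<in> F; B \<in> F\<rbrakk> \<Longrightarrow> set_encode A \<sqsubseteq>\<^bsub>H\<^esub> set_encode B \<longleftrightarrow> A \<subseteq> B"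
  by (simp add: set_heyting_def finite_member)

lemma himp_H:
  "\<lbrakk>A \<in> F; B \<in> F\<rbrakk> \<Longrightarrow> set_encode A \<leadsto>\<^bsub>H\<^esub> set_encode B = set_encode (set_imp F A B)"
  by (simp add: set_heyting_def finite_member)

text \<open>Since \<open>F\<close> is finite, closure under binary unions extends to all
  subfamilies; the empty one gives \<open>{}\<close>. This puts the top \<open>\<Union>F\<close> and
  all implications into \<open>F\<close>.\<close>

lemma Union_member:
  assumes "S \<subseteq> F"
  shows "\<Union>S \<in> F"
proof -
  have "finite S"
    using assms finite_family finite_subset by blast
  then show ?thesis
    using assms by induction (auto intro: empty_member Un_member)
qed

lemma set_imp_member: "set_imp F A B \<in> F"
  unfolding set_imp_def by (rule Union_member) auto

text \<open>This is residuation at the level of sets: intersection with \<open>A\<close> distributes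
  over the union defining \<open>set_imp\<close>, and any \<open>C\<close> satisfying the right side
  is one of the sets united.\<close>

lemma subset_set_imp_iff:
  assumes "C \<in> F"
  shows "C \<subseteq> set_imp F A B \<longleftrightarrow> C \<inter> A \<subseteq> B"
  using assms by (auto simp: set_imp_def)

lemma partial_order_H: "partial_order H"
proof
  fix x y assume "x \<sqsubseteq>\<^bsub>H\<^esub> y" "y \<sqsubseteq>\<^bsub>H\<^esub> x" "x \<in> carrier H" "y \<in> carrier H"
  then have "set_decode x = set_decode y"
    by (simp add: set_heyting_def)
  \<comment> \<open>\<open>set_encode\<close> inverts \<open>set_decode\<close> on every natural, so
    decoding is injective.\<close>
  then have "x = y"
    by (metis set_decode_inverse)
  then show "x .=\<^bsub>H\<^esub> y"
    by (simp add: set_heyting_def)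
qed (auto simp: set_heyting_def)

lemma least_join:
  assumes "A \<in> F" "B \<in> F"
  shows "least H (set_encode (A \<union> B)) (Upper H {set_encode A, set_encode B})"
  using assms by (auto simp: least_def Upper_def carrier_H le_H Un_member)

lemma greatest_meet:
  assumes "A \<in> F" "B \<in> F"
  shows "greatest H (set_encode (A \<inter> B)) (Lower H {set_encode A, set_encode B})"
  using assms by (auto simp: greatest_def Lower_def carrier_H le_H Int_member)

lemma least_bottom: "least H (set_encode {}) (carrier H)"
  unfolding least_def using le_H empty_member by (force simp: carrier_H)

lemma greatest_top: "greatest H (set_encode (\<Union>F)) (carrier H)"
  by (auto simp: greatest_def carrier_H le_H Union_member)

lemma bounded_lattice_H: "bounded_lattice H"
proof -
  interpret partial_order H by (rule partial_order_H)
  show ?thesis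
  proof
    fix x y assume "x \<in> carrier H" "y \<in> carrier H"
    then show "\<exists>s. least H s (Upper H {x, y})" "\<exists>s. greatest H s (Lower H {x, y})"
      unfolding carrier_H using least_join greatest_meet by blast+
  qed (use least_bottom greatest_top in auto)
qed

text \<open>The lattice operations are defined by Hilbert choice, so their values are identified
  through uniqueness of least and greatest elements.\<close>

lemma join_H:
  assumes "A \<in> F" "B \<in> F"
  shows "set_encode A \<squnion>\<^bsub>H\<^esub> set_encode B = set_encode (A \<union> B)"
proof -
  interpret partial_order H by (rule partial_order_H)
  show ?thesis
    unfolding join_def sup_def using least_join [OF assms] least_unique by (intro some_equality)
qed

lemma meet_H:
  assumes "A \<in> F" "B \<in> F"
  shows "set_encode A \<sqinter>\<^bsub>H\<^esub> set_encode B = set_encode (A \<inter> B)"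
proof -
  interpret partial_order H by (rule partial_order_H)
  show ?thesis
    unfolding meet_def inf_def using greatest_meet [OF assms] greatest_unique by (intro some_equality)
qed

lemma bottom_H: "\<bottom>\<^bsub>H\<^esub> = set_encode {}"
proof -
  interpret partial_order H by (rule partial_order_H)
  show ?thesis
    unfolding bottom_def using least_bottom least_unique by (intro some_equality)
qed

lemma heyting_algebra_H: "heyting_algebra H"
proof -
  interpret bounded_lattice H by (rule bounded_lattice_H)
  show ?thesis
  proof
    fix a b assume "a \<in> carrier H" "b \<in> carrier H"
    then show "a \<leadsto>\<^bsub>H\<^esub> b \<in> carrier H"
      by (auto simp: carrier_H himp_H set_imp_member)
  next
    fix a b c assume "a \<in> carrier H" "b \<in> carrier H" "c \<in> carrier H"
    then show "c \<sqsubseteq>\<^bsub>H\<^esub> a \<leadsto>\<^bsub>H\<^esub> b \<longleftrightarrow> c \<sqinter>\<^bsub>H\<^esub> a \<sqsubseteq>\<^bsub>H\<^esub> b"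
      by (auto simp: carrier_H himp_H meet_H le_H set_imp_member Int_member subset_set_imp_iff)
  qed
qed

section \<open>The equation and its degree of satisfiability, in terms of sets\<close>

lemma material_imp_H_iff:
  assumes "A \<in> F" "B \<in> F"
  shows "set_encode A \<leadsto>\<^bsub>H\<^esub> set_encode B = hneg H (set_encode A) \<squnion>\<^bsub>H\<^esub> set_encode B \<longleftrightarrow>
    set_imp F A B = set_imp F A {} \<union> B"
  using assms
  by (simp only: hneg_def bottom_H himp_H join_H encode_eq_iff set_imp_member Un_member empty_member)

text \<open>Encoding is injective on \<open>F\<close>, so pairs of codes can be counted as pairs of
  sets; passing to the complement leaves only the failures to be estimated.\<close>

lemma ds2_material_imp:
  "ds2 H (\<lambda>a b. a \<leadsto>\<^bsub>H\<^esub> b = hneg H a \<squnion>\<^bsub>H\<^esub> b) =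
    1 - real (card {(A, B) \<in> F \<times> F. set_imp F A B \<noteq> set_imp F A {} \<union> B}) / real (card F) ^ 2"
    (is "_ = 1 - real (card ?bad) / _")
proof -
  let ?good = "{(A, B) \<in> F \<times> F. set_imp F A B = set_imp F A {} \<union> B}"
  have "{(a, b) \<in> carrier H \<times> carrier H. a \<leadsto>\<^bsub>H\<^esub> b = hneg H a \<squnion>\<^bsub>H\<^esub> b} =
      map_prod set_encode set_encode ` ?good"
    by (auto simp: carrier_H material_imp_H_iff image_iff)
  moreover have "inj_on (map_prod set_encode set_encode) ?good"
    by (auto simp: inj_on_def encode_eq_iff)
  ultimately have ds: "ds2 H (\<lambda>a b. a \<leadsto>\<^bsub>H\<^esub> b = hneg H a \<squnion>\<^bsub>H\<^esub> b) =
      real (card ?good) / real (card F) ^ 2"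
    by (simp add: ds2_def card_image card_carrier_H)
  have fin: "finite (F \<times> F)"
    by (simp add: finite_family)
  have "card (?good \<union> ?bad) = card ?good + card ?bad"
    by (rule card_Un_disjoint) (auto intro: finite_subset [OF _ fin])
  moreover have "?good \<union> ?bad = F \<times> F"
    by auto
  ultimately have "card F * card F = card ?good + card ?bad"
    by (simp only: card_cartesian_product)
  then have "real (card F * card F) = real (card ?good + card ?bad)"
    by (rule arg_cong)
  then have "real (card ?good) = real (card F) ^ 2 - real (card ?bad)"
    by (simp only: power2_eq_square of_nat_mult of_nat_add add_diff_cancel_right')
  moreover have "card F \<noteq> 0"
    using finite_family empty_member by auto
  ultimately show ?thesis
    unfolding ds by (simp only: diff_divide_distrib) simp
qed

end

section \<open>The power set with a new top, and its implication\<close>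

definition topped_Pow :: "nat \<Rightarrow> nat set set"
  where "topped_Pow m = insert {..m} (Pow {..<m})"

lemma subset_atMost_if_topped_Pow: "A \<in> topped_Pow m \<Longrightarrow> A \<subseteq> {..m}"
  by (auto simp: topped_Pow_def)

lemma finite_set_lattice_topped_Pow: "finite_set_lattice (topped_Pow m)"
proof
  fix A B assume AB: "A \<in> topped_Pow m" "B \<in> topped_Pow m"
  then have "A \<subseteq> {..m}" "B \<subseteq> {..m}"
    by (auto dest: subset_atMost_if_topped_Pow)
  then show "A \<union> B \<in> topped_Pow m" "A \<inter> B \<in> topped_Pow m"
    using AB by (auto simp: topped_Pow_def Un_absorb1 Un_absorb2 Int_absorb1 Int_absorb2)
qed (auto simp: topped_Pow_def intro: finite_subset)

lemma card_topped_Pow: "card (topped_Pow m) = 2 ^ m + 1"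
proof -
  \<comment> \<open>The extra point \<open>m\<close> separates the new top from the old top
    \<open>{..<m}\<close>.\<close>
  have "{..m} \<notin> Pow {..<m}"
    by auto
  then show ?thesis
    by (simp add: topped_Pow_def card_Pow)
qed

lemma set_imp_topped_Pow_subset:
  assumes "A \<subseteq> B"
  shows "set_imp (topped_Pow m) A B = {..m}"
  using assms unfolding set_imp_def topped_Pow_def by auto

text \<open>The new top meets \<open>A\<close> in \<open>A\<close> itself, so it is not among the
  sets united by \<open>set_imp\<close>. Only subsets of \<open>{..<m}\<close> compete, and the
  largest is the Boolean implication.\<close>

lemma set_imp_topped_Pow_not_subset:
  assumes "B \<in> topped_Pow m" "A \<in> topped_Pow m" "\<not> A \<subseteq> B"
  shows "set_imp (topped_Pow m) A B = ({..<m} - A) \<union> B"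
proof
  have "A \<subseteq> {..m}"
    using assms subset_atMost_if_topped_Pow by blast
  then have "C \<subseteq> {..<m}" if "C \<in> topped_Pow m" "C \<inter> A \<subseteq> B" for C
    using that assms by (auto simp: topped_Pow_def)
  then show "set_imp (topped_Pow m) A B \<subseteq> ({..<m} - A) \<union> B"
    unfolding set_imp_def by blast
  \<comment> \<open>\<open>B\<close> is not the new top, for that would contain
    \<open>A\<close>.\<close>
  have "B \<subseteq> {..<m}"
    using assms \<open>A \<subseteq> {..m}\<close> by (auto simp: topped_Pow_def)
  then have "({..<m} - A) \<union> B \<in> {C \<in> topped_Pow m. C \<inter> A \<subseteq> B}"
    by (auto simp: topped_Pow_def)
  then show "({..<m} - A) \<union> B \<subseteq> set_imp (topped_Pow m) A B"
    unfolding set_imp_def by (rule Union_upper)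
qed

lemma material_imp_topped_Pow:
  assumes "A \<in> topped_Pow m" "B \<in> topped_Pow m" "\<not> (A \<subseteq> B \<and> B \<subseteq> {..<m})"
  shows "set_imp (topped_Pow m) A B = set_imp (topped_Pow m) A {} \<union> B"
proof (cases "A \<subseteq> B")
  case True
  \<comment> \<open>Here both sides of the equation are the new top.\<close>
  then have "B = {..m}"
    using assms by (auto simp: topped_Pow_def)
  moreover have "set_imp (topped_Pow m) A {} \<subseteq> {..m}"
    unfolding set_imp_def by (auto dest: subset_atMost_if_topped_Pow)
  ultimately show ?thesis
    using set_imp_topped_Pow_subset [OF True] by auto
next
  case False
  \<comment> \<open>Hence the Boolean formula applies to the negation of \<open>A\<close> as
    well.\<close>
  moreover from this have "\<not> A \<subseteq> {}"
    by auto
  moreover have "{} \<in> topped_Pow m"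
    by (simp add: topped_Pow_def)
  ultimately show ?thesis
    using assms by (simp add: set_imp_topped_Pow_not_subset)
qed

lemma material_imp_topped_Pow_fails:
  assumes "m > 0"
  shows "set_imp (topped_Pow m) {0} {0} \<noteq> set_imp (topped_Pow m) {0} {} \<union> {0}"
proof -
  have "set_imp (topped_Pow m) {0} {} = {..<m} - {0}"
    using assms by (subst set_imp_topped_Pow_not_subset) (auto simp: topped_Pow_def)
  \<comment> \<open>The point \<open>m\<close>, which lies in the new top only, tells the two sides
    apart.\<close>
  then have "m \<notin> set_imp (topped_Pow m) {0} {} \<union> {0}"
    using assms by auto
  moreover have "m \<in> set_imp (topped_Pow m) {0} {0}"
    by (simp add: set_imp_topped_Pow_subset)
  ultimately show ?thesis
    by blast
qed

section \<open>Counting nested pairs of subsets\<close>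

lemma sum_Pow_power_card:
  fixes x :: "'b :: comm_semiring_1"
  assumes "finite S"
  shows "(\<Sum>B\<in>Pow S. x ^ card B) = (x + 1) ^ card S"
  \<comment> \<open>The binomial theorem, read off by expanding the product of \<open>x + 1\<close>
    over \<open>S\<close>: each subset records the factors that contribute \<open>x\<close>.\<close>
  using prod_add [OF assms, of "\<lambda>_. x" "\<lambda>_. 1"] by simp

text \<open>Each point of \<open>S\<close> has three options: in both sets, in \<open>B\<close>
  only, or in neither. The proof groups the pairs by \<open>B\<close>, which gives
  \<open>2 ^ card B\<close> choices of \<open>A\<close>, and uses \<open>3 = 2 + 1\<close>.\<close>

lemma card_subset_pairs:
  assumes "finite S"
  shows "card {(A, B). A \<subseteq> B \<and> B \<subseteq> S} = 3 ^ card S"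
proof -
  have "{(A, B). A \<subseteq> B \<and> B \<subseteq> S} = prod.swap ` (SIGMA B:Pow S. Pow B)"
    by auto
  then have "card {(A, B). A \<subseteq> B \<and> B \<subseteq> S} = card (SIGMA B:Pow S. Pow B)"
    by (simp add: card_image)
  also have "\<dots> = (\<Sum>B\<in>Pow S. card (Pow B))"
    using assms by (intro card_SigmaI) (auto intro: finite_subset)
  also have "\<dots> = (\<Sum>B\<in>Pow S. 2 ^ card B)"
    using assms by (intro sum.cong refl card_Pow) (auto intro: finite_subset)
  finally show ?thesis
    using sum_Pow_power_card [OF assms, of "2 :: nat"] by simp
qed

section \<open>Bounds on the degree of satisfiability\<close>

lemma ds2_topped_Pow:
  fixes m :: nat
  defines "H \<equiv> set_heyting (topped_Pow m)"
  assumes "m > 0"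
  shows "ds2 H (\<lambda>a b. a \<leadsto>\<^bsub>H\<^esub> b = hneg H a \<squnion>\<^bsub>H\<^esub> b) < 1"
    and "ds2 H (\<lambda>a b. a \<leadsto>\<^bsub>H\<^esub> b = hneg H a \<squnion>\<^bsub>H\<^esub> b) \<ge> 1 - (3 / 4) ^ m"
proof -
  interpret finite_set_lattice "topped_Pow m"
    by (rule finite_set_lattice_topped_Pow)
  let ?F = "topped_Pow m"
  define bad where "bad = {(A, B) \<in> ?F \<times> ?F. set_imp ?F A B \<noteq> set_imp ?F A {} \<union> B}"
  let ?N = "real (card ?F)"
  have ds: "ds2 H (\<lambda>a b. a \<leadsto>\<^bsub>H\<^esub> b = hneg H a \<squnion>\<^bsub>H\<^esub> b) = 1 - real (card bad) / ?N ^ 2"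
    unfolding H_def bad_def by (rule ds2_material_imp)
  have "?N > 0"
    unfolding card_topped_Pow of_nat_0_less_iff by simp
  have "finite bad"
    by (rule finite_subset [of _ "?F \<times> ?F"]) (auto simp: bad_def finite_family)
  \<comment> \<open>One failing pair makes the upper bound strict; \<open>m > 0\<close> makes
    \<open>{0}\<close> a member of the lattice below the new top.\<close>
  moreover have "({0}, {0}) \<in> bad"
    using assms material_imp_topped_Pow_fails by (auto simp: bad_def topped_Pow_def)
  ultimately have "card bad > 0"
    by (auto simp: card_gt_0_iff)
  then show "ds2 H (\<lambda>a b. a \<leadsto>\<^bsub>H\<^esub> b = hneg H a \<squnion>\<^bsub>H\<^esub> b) < 1"
    using \<open>?N > 0\<close> by (simp add: ds)
  let ?pairs = "{(A, B). A \<subseteq> B \<and> B \<subseteq> {..<m}}"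
  have "card bad \<le> card ?pairs"
  proof (rule card_mono)
    show "bad \<subseteq> ?pairs"
      unfolding bad_def using material_imp_topped_Pow by blast
    show "finite ?pairs"
      by (rule finite_subset [of _ "Pow {..<m} \<times> Pow {..<m}"]) auto
  qed
  then have "card bad \<le> 3 ^ m"
    by (simp add: card_subset_pairs)
  then have "real (card bad) \<le> real (3 ^ m)"
    by (rule of_nat_mono)
  then have "real (card bad) \<le> 3 ^ m"
    by (simp only: of_nat_power of_nat_numeral)
  \<comment> \<open>The estimate drops the summand 1 in \<open>card ?F = 2 ^ m + 1\<close>.\<close>
  moreover have "(4 :: real) ^ m \<le> ?N ^ 2"
  proof -
    have "(4 :: real) ^ m = 2 ^ (2 * m)"
      by (simp add: power_mult)
    also have "\<dots> = (2 ^ m) ^ 2"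
      by (rule power_even_eq)
    also have "\<dots> \<le> ?N ^ 2"
      by (intro power_mono) (simp_all add: card_topped_Pow)
    finally show ?thesis .
  qed
  ultimately have "real (card bad) / ?N ^ 2 \<le> 3 ^ m / 4 ^ m"
    by (intro frac_le) simp_all
  then show "ds2 H (\<lambda>a b. a \<leadsto>\<^bsub>H\<^esub> b = hneg H a \<squnion>\<^bsub>H\<^esub> b) \<ge> 1 - (3 / 4) ^ m"
    by (simp add: ds power_divide)
qed

theorem theorem3p15:
  shows "\<exists>H :: nat \<Rightarrow> nat heyting.
    (\<forall>n. heyting_algebra (H n) \<and> finite (carrier (H n))) \<and>
    (\<forall>n. 1 > ds2 (H n) (\<lambda>a b. a \<leadsto>\<^bsub>H n\<^esub> b = hneg (H n) a \<squnion>\<^bsub>H n\<^esub> b) \<and>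
         ds2 (H n) (\<lambda>a b. a \<leadsto>\<^bsub>H n\<^esub> b = hneg (H n) a \<squnion>\<^bsub>H n\<^esub> b) \<ge> 1 - (3 / 4) ^ (n + 1))"
proof -
  \<comment> \<open>The shift to \<open>n + 1\<close> matches the exponent and avoids
    \<open>m = 0\<close>, where no failing pair is available.\<close>
  let ?H = "\<lambda>n. set_heyting (topped_Pow (n + 1))"
  have "heyting_algebra (?H n)" "finite (carrier (?H n))" for n
    using finite_set_lattice_topped_Pow finite_set_lattice.heyting_algebra_H
      finite_set_lattice.finite_carrier_H by blast+
  moreover have "1 > ds2 (?H n) (\<lambda>a b. a \<leadsto>\<^bsub>?H n\<^esub> b = hneg (?H n) a \<squnion>\<^bsub>?H n\<^esub> b)"
    "ds2 (?H n) (\<lambda>a b. a \<leadsto>\<^bsub>?H n\<^esub> b = hneg (?H n) a \<squnion>\<^bsub>?H n\<^esub> b) \<ge> 1 - (3 / 4) ^ (n + 1)" for n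
    using ds2_topped_Pow [of "n + 1"] by simp_all
  ultimately show ?thesis
    by (intro exI [of _ ?H]) blast
qed

end
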